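(* For every integer $n\ge 0$, the Euler characteristic $\chi(\mathcal{S}_{2,n})=\sum_{d\ge0}(-1)^d c_{n,d}$ of the configuration space $\mathcal{S}_{2,n}$ equals $1$, where $c_{n,d}$ is the number of $d$-dimensional cubes of $\mathcal{S}_{2,n}$.
   Context: **Positions.** A position of the robotic arm of length $n$ in a tunnel of width $2$ is a lattice path of $n$ unit links starting at $(0,0)$, each link facing up ($u$), down ($d$) or right ($r$), staying in the strip $0\le y\le 2$ and not intersecting itself; equivalently a word in $\{u,d,r\}^n$ with no two consecutive letters $ud$ or $du$ and all heights in $[0,2]$. For $n=0$ there is exactly one (empty) position. **Moves.** (Switch corners) two consecutive links facing different directions (one vertical, one horizontal) interchange directions; (flip the end) the last link rotates by $90^\circ$ ($r\leftrightarrow u$ or $r\leftrightarrow d$). A move is legal only if its result is a position. **Configuration space.** $\mathcal{S}_{2,n}$ is the cubical complex whose vertices are the positions, whose edges are the legal moves, and whose $k$-cubes correspond to $k$-tuples of commutative moves: given $k$ moves applicable at a position $p$, acting on pairwise disjoint sets of links and such that performing any subset of them yields a position, the $2^k$ positions obtained from $p$ by performing the subsets of these moves are the vertices of a $k$-cube (a cube is determined by its set of vertices). *)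

theory Defs
  imports Main
begin

datatype link = Up | Down | Right

fun path_vertices :: "int \<times> int \<Rightarrow> link list \<Rightarrow> (int \<times> int) list" where
  "path_vertices v [] = [v]"
| "path_vertices (x, y) (Up # p) = (x, y) # path_vertices (x, y + 1) p"
| "path_vertices (x, y) (Down # p) = (x, y) # path_vertices (x, y - 1) p"
| "path_vertices (x, y) (Right # p) = (x, y) # path_vertices (x + 1, y) p"

(* Distinct unit links of the integer grid can only meet in lattice points, so the arm does not
   intersect itself iff the n + 1 endpoints of its links are distinct. *)
definition positions :: "nat \<Rightarrow> link list set" where
  "positions n = {p. length p = n
     \<and> distinct (path_vertices (0, 0) p)
     \<and> (\<forall>(x, y) \<in> set (path_vertices (0, 0) p). 0 \<le> y \<and> y \<le> 2)}"

(* Links are numbered from 0. Switch i concerns the corner between links i and i + 1;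
   Flip l turns the last link into the direction l. *)
datatype move = Switch nat | Flip link

fun move_possible :: "link list \<Rightarrow> move \<Rightarrow> bool" where
  "move_possible p (Switch i) \<longleftrightarrow> i + 1 < length p \<and> (p ! i = Right) \<noteq> (p ! (i + 1) = Right)"
| "move_possible p (Flip l) \<longleftrightarrow> p \<noteq> [] \<and> (last p = Right) \<noteq> (l = Right)"

fun perform :: "move \<Rightarrow> link list \<Rightarrow> link list" where
  "perform (Switch i) p = p[i := p ! (i + 1), i + 1 := p ! i]"
| "perform (Flip l) p = p[length p - 1 := l]"

fun links_moved :: "nat \<Rightarrow> move \<Rightarrow> nat set" where
  "links_moved n (Switch i) = {i, i + 1}"
| "links_moved n (Flip l) = {n - 1}"

definition legal_move :: "nat \<Rightarrow> link list \<Rightarrow> move \<Rightarrow> bool" where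
  "legal_move n p m \<longleftrightarrow> move_possible p m \<and> perform m p \<in> positions n"

(* The moves are given as a k-tuple ms, and its subsets as the subsequences of ms. Moves acting
   on disjoint sets of links commute, so the order in which they are performed is immaterial. *)
definition cube_vertices :: "link list \<Rightarrow> move list \<Rightarrow> link list set" where
  "cube_vertices p ms = (\<lambda>qs. fold perform qs p) ` set (subseqs ms)"

definition commutative_moves :: "nat \<Rightarrow> link list \<Rightarrow> move list \<Rightarrow> bool" where
  "commutative_moves n p ms \<longleftrightarrow>
     (\<forall>m \<in> set ms. legal_move n p m)
     \<and> (\<forall>i j. i < j \<and> j < length ms \<longrightarrow> links_moved n (ms ! i) \<inter> links_moved n (ms ! j) = {})
     \<and> cube_vertices p ms \<subseteq> positions n"

(* The k-dimensional cubes of the configuration space, each identified with its vertex set. *)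
definition cubes :: "nat \<Rightarrow> nat \<Rightarrow> link list set set" where
  "cubes n k = {cube_vertices p ms | p ms.
     p \<in> positions n \<and> length ms = k \<and> commutative_moves n p ms}"

(* Only finitely many dimensions contribute, since commuting moves act on disjoint nonempty
   subsets of the n links; hence the sum is over the support. *)
definition euler_characteristic :: "nat \<Rightarrow> int" where
  "euler_characteristic n = (\<Sum>d | cubes n d \<noteq> {}. (- 1) ^ d * int (card (cubes n d)))"

end

theory Submission
  imports Defs
begin

text \<open>
  All vertices of a cube pass through the same height wherever the block of links moved by one of
  its moves starts, and also where it ends unless the move flips the last link. So a cube is a word
  in three kinds of blocks: a fixed link, a corner that is free to switch, and a last link that is
  free to flip. Reading the word from the left, validity only depends on the current height and on
  the vertical direction (if any) of the preceding block. A vertical fixed link \<open>l\<close> and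
  a free corner made of \<open>l\<close> and a horizontal link (or a free last link, if only one
  link remains) are admissible in the same states and lead to the same state, but contribute
  opposite signs. By induction on the number of remaining links, the signed number of completions is
  therefore 1 from every state: only the first block \<open>Right\<close> survives.
\<close>

section \<open>Positions as locally constrained words\<close>

fun rise :: "link \<Rightarrow> int" where
  "rise Up = 1"
| "rise Down = -1"
| "rise Right = 0"

text \<open>\<open>prev\<close> is the direction of the preceding link. \<open>Right\<close> also
  serves as the initial state, as it imposes no constraint on the next link.\<close>

fun admissible :: "link \<Rightarrow> int \<Rightarrow> link \<Rightarrow> bool" where
  "admissible prev h Up \<longleftrightarrow> prev \<noteq> Down \<and> h < 2"
| "admissible prev h Down \<longleftrightarrow> prev \<noteq> Up \<and> 0 < h"
| "admissible prev h Right \<longleftrightarrow> True"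

fun valid_path :: "link \<Rightarrow> int \<Rightarrow> link list \<Rightarrow> bool" where
  "valid_path prev h [] \<longleftrightarrow> True"
| "valid_path prev h (l # p) \<longleftrightarrow> admissible prev h l \<and> valid_path l (h + rise l) p"

lemma valid_path_Right: "valid_path prev h p \<Longrightarrow> valid_path Right h p"
proof (cases p)
  case (Cons l q)
  then show "valid_path prev h p \<Longrightarrow> valid_path Right h p" by (cases l) auto
qed simp

lemma hd_path_vertices: "v \<in> set (path_vertices v p)"
  by (induction v p rule: path_vertices.induct) auto

text \<open>Links never face left, and without reversals a path stays on one side of its start
  within the starting column. After a vertical first link this keeps the path away from the vertex
  just left, which gives distinctness.\<close>

lemma valid_path_vertices:
  assumes "valid_path prev h p" "(x', y') \<in> set (path_vertices (x, h) p)"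
  shows "x \<le> x' \<and> (x' = x \<longrightarrow> (prev = Up \<longrightarrow> h \<le> y') \<and> (prev = Down \<longrightarrow> y' \<le> h))"
  using assms
proof (induction p arbitrary: prev h x)
  case (Cons l q)
  then show ?case by (cases l) fastforce+
qed simp

lemma valid_path_strip:
  assumes "valid_path prev h p" "0 \<le> h" "h \<le> 2" "(x', y') \<in> set (path_vertices (x, h) p)"
  shows "0 \<le> y' \<and> y' \<le> 2"
  using assms
proof (induction p arbitrary: prev h x)
  case (Cons l q)
  then show ?case by (cases l) fastforce+
qed simp

lemma valid_path_distinct:
  "valid_path prev h p \<Longrightarrow> distinct (path_vertices (x, h) p)"
proof (induction p arbitrary: prev h x)
  case (Cons l q)
  then show ?case by (cases l) (auto dest: valid_path_vertices)
qed simp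

text \<open>The last two hypotheses say that the vertex before a vertical link \<open>prev\<close>
  is not revisited; a reversal would hit exactly that vertex. In the induction they come from
  distinctness.\<close>

lemma distinct_valid_path:
  assumes "distinct (path_vertices (x, h) p)"
    "\<forall>(x', y') \<in> set (path_vertices (x, h) p). 0 \<le> y' \<and> y' \<le> 2"
    "prev = Up \<Longrightarrow> (x, h - 1) \<notin> set (path_vertices (x, h) p)"
    "prev = Down \<Longrightarrow> (x, h + 1) \<notin> set (path_vertices (x, h) p)"
  shows "valid_path prev h p"
  using assms
proof (induction p arbitrary: prev h x)
  case (Cons l q)
  show ?case
  proof (cases l)
    case Up
    then have "valid_path Up (h + 1) q" using Cons.prems by (intro Cons.IH) auto
    then show ?thesis using Up Cons.prems hd_path_vertices[of "(x, h + 1)" q] by auto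
  next
    case Down
    then have "valid_path Down (h - 1) q" using Cons.prems by (intro Cons.IH) auto
    then show ?thesis using Down Cons.prems hd_path_vertices[of "(x, h - 1)" q] by auto
  next
    case Right
    then have "valid_path Right h q" using Cons.prems by (intro Cons.IH) auto
    then show ?thesis using Right by simp
  qed
qed simp

lemma positions_eq: "positions n = {p. length p = n \<and> valid_path Right 0 p}"
proof -
  have "distinct (path_vertices (0, 0) p)
      \<and> (\<forall>(x, y) \<in> set (path_vertices (0, 0) p). 0 \<le> y \<and> y \<le> 2) \<longleftrightarrow> valid_path Right 0 p" for p
    using distinct_valid_path[of 0 0 p Right] valid_path_distinct[of Right 0 p 0]
      valid_path_strip[of Right 0 p] by fastforce
  then show ?thesis by (auto simp: positions_def)
qed

section \<open>Block words\<close>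

datatype block = Fixed link | Corner link | End link

fun wf_word :: "block list \<Rightarrow> bool" where
  "wf_word [] \<longleftrightarrow> True"
| "wf_word (Fixed l # w) \<longleftrightarrow> wf_word w"
| "wf_word (Corner l # w) \<longleftrightarrow> l \<noteq> Right \<and> wf_word w"
| "wf_word (End l # w) \<longleftrightarrow> l \<noteq> Right \<and> w = []"

fun word_length :: "block list \<Rightarrow> nat" where
  "word_length [] = 0"
| "word_length (Fixed l # w) = Suc (word_length w)"
| "word_length (Corner l # w) = Suc (Suc (word_length w))"
| "word_length (End l # w) = Suc (word_length w)"

fun dim :: "block list \<Rightarrow> nat" where
  "dim [] = 0"
| "dim (Fixed l # w) = dim w"
| "dim (Corner l # w) = Suc (dim w)"
| "dim (End l # w) = Suc (dim w)"

fun resolutions :: "block list \<Rightarrow> link list set" where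
  "resolutions [] = {[]}"
| "resolutions (Fixed l # w) = (#) l ` resolutions w"
| "resolutions (Corner l # w) =
     (\<lambda>q. l # Right # q) ` resolutions w \<union> (\<lambda>q. Right # l # q) ` resolutions w"
| "resolutions (End l # w) = (#) l ` resolutions w \<union> (#) Right ` resolutions w"

fun valid_word :: "link \<Rightarrow> int \<Rightarrow> block list \<Rightarrow> bool" where
  "valid_word prev h [] \<longleftrightarrow> True"
| "valid_word prev h (Fixed l # w) \<longleftrightarrow> admissible prev h l \<and> valid_word l (h + rise l) w"
| "valid_word prev h (Corner l # w) \<longleftrightarrow>
     l \<noteq> Right \<and> admissible prev h l \<and> valid_word l (h + rise l) w"
| "valid_word prev h (End l # w) \<longleftrightarrow> l \<noteq> Right \<and> admissible prev h l \<and> w = []"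

lemma resolutions_nonempty: "resolutions w \<noteq> {}"
  by (induction w rule: resolutions.induct) auto

lemma length_resolutions: "q \<in> resolutions w \<Longrightarrow> length q = word_length w"
  by (induction w arbitrary: q rule: resolutions.induct) auto

text \<open>Of the two orders of a corner, the one starting with \<open>l\<close> constrains what
  precedes and the one ending with \<open>l\<close> constrains what follows. The conditions of the
  other order are weaker, because \<open>Right\<close> is the least restrictive predecessor.\<close>

lemma valid_word_iff:
  "valid_word prev h w \<longleftrightarrow> wf_word w \<and> (\<forall>q \<in> resolutions w. valid_path prev h q)"
proof (induction prev h w rule: valid_word.induct)
  case (2 prev h l w)
  then show ?case using resolutions_nonempty[of w] by auto
next
  case (3 prev h l w)
  have "admissible Right h l" if "admissible prev h l" using that by (cases l) auto
  then show ?case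
    using 3 resolutions_nonempty[of w] valid_path_Right[of l "h + rise l"]
    by (auto simp: ball_Un)
qed auto

text \<open>Cubes are vertex sets, so counting them by words needs this. The first letters reveal
  the first block: a fixed block shows one letter, a free one shows both \<open>Right\<close> and
  its vertical link. \<open>Corner\<close> and \<open>End\<close> differ in length.\<close>

lemma resolutions_inj:
  assumes "resolutions v = resolutions w" "word_length v = word_length w" "wf_word v" "wf_word w"
  shows "v = w"
  using assms
proof (induction v arbitrary: w)
  case Nil
  then show ?case by (cases w rule: word_length.cases) auto
next
  case (Cons b v)
  have "w \<noteq> []" using Cons.prems(2) by (cases b) auto
  then obtain c w' where w: "w = c # w'" by (cases w) auto
  have fixed: "resolutions (Fixed l # u) \<noteq> resolutions (d # u')"
    if "d = Corner k \<or> d = End k" "k \<noteq> Right" for l u d k u'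
  proof
    assume eq: "resolutions (Fixed l # u) = resolutions (d # u')"
    obtain q where q: "q \<in> resolutions u'" using resolutions_nonempty[of u'] by blast
    from that(1) have "\<exists>r r'. k # r \<in> resolutions (d # u') \<and> Right # r' \<in> resolutions (d # u')"
      by (elim disjE) (use q in \<open>simp add: image_iff, blast\<close>)+
    then obtain r r' where "k # r \<in> resolutions (Fixed l # u)" "Right # r' \<in> resolutions (Fixed l # u)"
      using eq by metis
    then show False using that(2) by auto
  qed
  have rest: "v = w'" if "resolutions v = resolutions w'" "word_length v = word_length w'"
  proof (rule Cons.IH[OF that])
    show "wf_word v" using Cons.prems(3) by (cases b) auto
    show "wf_word w'" using Cons.prems(4) w by (cases c) auto
  qed
  \<comment> \<open>Resolutions starting with the vertical link isolate one half of the union, from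
    which both the link and the tail can be read off.\<close>
  have mem_corner: "l # Right # q \<in> resolutions (Corner k # u) \<longleftrightarrow> l = k \<and> q \<in> resolutions u"
    if "l \<noteq> Right" "k \<noteq> Right" for l k q u
    using that by auto
  have bc: "wf_word (b # v)" "wf_word (c # w')" "resolutions (b # v) = resolutions (c # w')"
    "word_length (b # v) = word_length (c # w')"
    using Cons.prems w by simp_all
  consider l k where "b = Fixed l" "c = Fixed k"
    | l k where "b = Corner l" "c = Corner k" | l k where "b = End l" "c = End k"
  proof (cases b; cases c)
    fix l k assume "b = Fixed l" "c = Corner k"
    then show thesis using bc fixed[of c k l v w'] by auto
  next
    fix l k assume "b = Fixed l" "c = End k"
    then show thesis using bc fixed[of c k l v w'] by auto
  next
    fix l k assume "b = Corner k" "c = Fixed l"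
    then show thesis using bc fixed[of b k l w' v] by auto
  next
    fix l k assume "b = End k" "c = Fixed l"
    then show thesis using bc fixed[of b k l w' v] by auto
  qed (use bc in auto)
  then show ?case
  proof cases
    case 1
    obtain q q' where "q \<in> resolutions v" "q' \<in> resolutions w'"
      using resolutions_nonempty by blast
    then have "l = k" using 1 Cons.prems(1) w by auto
    moreover have "resolutions v = resolutions w'"
      using Cons.prems(1) 1 w \<open>l = k\<close> by (simp add: inj_image_eq_iff)
    ultimately show ?thesis using rest 1 Cons.prems w by simp
  next
    case 2
    obtain q where q: "q \<in> resolutions v" using resolutions_nonempty by blast
    have nR: "l \<noteq> Right" "k \<noteq> Right" using Cons.prems 2 w by auto
    have eq: "resolutions (Corner l # v) = resolutions (Corner k # w')" using Cons.prems(1) 2 w by simp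
    have "l # Right # q \<in> resolutions (Corner l # v)" using q mem_corner nR by blast
    then have "l = k" using eq mem_corner nR by blast
    moreover have "resolutions v = resolutions w'"
      using eq mem_corner nR \<open>l = k\<close> by blast
    ultimately show ?thesis using rest 2 Cons.prems w by simp
  next
    case 3
    then show ?thesis using Cons.prems w by auto
  qed
qed

section \<open>The signed number of block words\<close>

definition words :: "nat \<Rightarrow> link \<Rightarrow> int \<Rightarrow> block list set" where
  "words m prev h = {w. valid_word prev h w \<and> word_length w = m}"

lemma words_0: "words 0 prev h = {[]}"
  by (auto simp: words_def elim: word_length.elims)

lemma finite_links: "finite (S :: link set)"
proof (rule finite_subset)
  show "S \<subseteq> {Up, Down, Right}" using link.exhaust by auto
qed simp

text \<open>Split by the first block. A free block is an \<open>End\<close> exactly when one link is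
  left, so each admissible vertical link gives exactly one family of words with a free first
  block.\<close>

lemma words_Suc:
  "words (Suc m) prev h =
     (\<Union>l \<in> {l. admissible prev h l}. (#) (Fixed l) ` words m l (h + rise l))
     \<union> (\<Union>l \<in> {l. admissible prev h l \<and> l \<noteq> Right}.
          case m of 0 \<Rightarrow> {[End l]} | Suc m' \<Rightarrow> (#) (Corner l) ` words m' l (h + rise l))"
  (is "_ = ?F \<union> ?G")
proof (intro equalityI subsetI)
  fix w assume "w \<in> words (Suc m) prev h"
  then show "w \<in> ?F \<union> ?G"
    by (cases w rule: word_length.cases) (auto simp: words_def split: nat.splits)
next
  fix w assume "w \<in> ?F \<union> ?G"
  then show "w \<in> words (Suc m) prev h"
    by (cases m) (auto simp: words_def)
qed

lemma finite_words: "finite (words m prev h)"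
proof (induction m arbitrary: prev h rule: less_induct)
  case (less m)
  then show ?case
    by (cases m) (auto simp: words_0 words_Suc finite_links split: nat.splits)
qed

lemma signed_count_words: "(\<Sum>w \<in> words m prev h. (- 1) ^ dim w) = (1 :: int)"
proof (induction m arbitrary: prev h rule: less_induct)
  case (less m)
  show ?case
  proof (cases m)
    case 0
    then show ?thesis by (simp add: words_0)
  next
    case (Suc k)
    let ?A = "{l. admissible prev h l}" and ?B = "{l. admissible prev h l \<and> l \<noteq> Right}"
    define F where "F l = (#) (Fixed l) ` words k l (h + rise l)" for l
    define G where "G l = (case k of 0 \<Rightarrow> {[End l]}
      | Suc k' \<Rightarrow> (#) (Corner l) ` words k' l (h + rise l))" for l
    have fin: "finite (F l)" "finite (G l)" for l
      by (auto simp: F_def G_def finite_words split: nat.splits)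
    have F: "(\<Sum>w \<in> F l. (- 1) ^ dim w) = (1 :: int)" for l
      using less[of k] Suc by (simp add: F_def sum.reindex)
    \<comment> \<open>The free first block adds one to \<open>dim\<close>, hence the sign; a
      \<open>Corner\<close> uses two links, hence the strong induction.\<close>
    have G: "(\<Sum>w \<in> G l. (- 1) ^ dim w) = (- 1 :: int)" for l
      using less Suc by (auto simp: G_def sum.reindex sum_negf split: nat.splits)
    have "(\<Sum>w \<in> words m prev h. (- 1) ^ dim w) = (\<Sum>w \<in> \<Union> (F ` ?A) \<union> \<Union> (G ` ?B). (- 1) ^ dim w :: int)"
      unfolding Suc words_Suc F_def G_def ..
    also have "\<dots> = (\<Sum>w \<in> \<Union> (F ` ?A). (- 1) ^ dim w) + (\<Sum>w \<in> \<Union> (G ` ?B). (- 1) ^ dim w)"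
      by (rule sum.union_disjoint)
        (auto simp: finite_links fin, auto simp: F_def G_def split: nat.splits)
    also have "(\<Sum>w \<in> \<Union> (F ` ?A). (- 1) ^ dim w) = (\<Sum>l \<in> ?A. \<Sum>w \<in> F l. (- 1) ^ dim w :: int)"
      by (rule sum.UNION_disjoint) (auto simp: finite_links fin, auto simp: F_def)
    also have "(\<Sum>w \<in> \<Union> (G ` ?B). (- 1) ^ dim w) = (\<Sum>l \<in> ?B. \<Sum>w \<in> G l. (- 1) ^ dim w :: int)"
      by (rule sum.UNION_disjoint)
        (auto simp: finite_links fin, auto simp: G_def split: nat.splits)
    also have "(\<Sum>l \<in> ?A. \<Sum>w \<in> F l. (- 1) ^ dim w) + (\<Sum>l \<in> ?B. \<Sum>w \<in> G l. (- 1) ^ dim w)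
        = int (card ?A) - int (card ?B)"
      by (simp add: F G)
    \<comment> \<open>Vertical links cancel in pairs; \<open>Right\<close> is always admissible and
      has no free partner.\<close>
    also have "?A = insert Right ?B" by auto
    also have "int (card (insert Right ?B)) - int (card ?B) = 1"
      by (simp add: finite_links)
    finally show ?thesis .
  qed
qed

section \<open>Cubes as block words\<close>

lemma cube_vertices_Nil: "cube_vertices p [] = {p}"
  by (simp add: cube_vertices_def)

lemma cube_vertices_Cons:
  "cube_vertices p (m # ms) = cube_vertices p ms \<union> cube_vertices (perform m p) ms"
  by (auto simp: cube_vertices_def Let_def image_Un image_image)

lemma base_in_cube_vertices: "p \<in> cube_vertices p ms"
  by (induction ms arbitrary: p) (auto simp: cube_vertices_Nil cube_vertices_Cons)

lemma perform_in_cube_vertices: "m \<in> set ms \<Longrightarrow> perform m p \<in> cube_vertices p ms"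
  by (induction ms arbitrary: p) (auto simp: cube_vertices_Cons base_in_cube_vertices)

lemma length_perform: "length (perform m p) = length p"
  by (cases m) auto

lemma perform_commute:
  assumes "links_moved (length p) m \<inter> links_moved (length p) m' = {}"
    "links_moved (length p) m \<subseteq> {..<length p}" "links_moved (length p) m' \<subseteq> {..<length p}"
  shows "perform m (perform m' p) = perform m' (perform m p)"
  using assms
  by (cases m; cases m')
    (auto intro!: nth_equalityI simp: nth_list_update list_update_swap)

text \<open>The tuple of moves comes in arbitrary order, while a word is read from left to right;
  this brings the move of the leftmost link to the front.\<close>

lemma cube_vertices_move_to_front:
  assumes "\<forall>x \<in> set xs. links_moved (length p) x \<inter> links_moved (length p) m = {}"
    "\<forall>x \<in> set (m # xs). links_moved (length p) x \<subseteq> {..<length p}"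
  shows "cube_vertices p (xs @ m # ys) = cube_vertices p (m # xs @ ys)"
  using assms
proof (induction xs arbitrary: p)
  case (Cons x xs)
  have "perform m (perform x p) = perform x (perform m p)"
    using Cons.prems by (intro perform_commute) auto
  moreover have "cube_vertices p (xs @ m # ys) = cube_vertices p (m # xs @ ys)"
    using Cons.prems by (intro Cons.IH) auto
  moreover have "cube_vertices (perform x p) (xs @ m # ys) = cube_vertices (perform x p) (m # xs @ ys)"
    using Cons.prems by (intro Cons.IH) (auto simp: length_perform)
  ultimately show ?case by (auto simp: cube_vertices_Cons)
qed simp

text \<open>The suffix \<open>s\<close> of a position starts at link number \<open>k\<close>; moves keep their absolute numbering.\<close>

fun possible_after :: "nat \<Rightarrow> link list \<Rightarrow> move \<Rightarrow> bool" where
  "possible_after k s (Switch i) \<longleftrightarrow>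
     k \<le> i \<and> i + 1 < k + length s \<and> (s ! (i - k) = Right) \<noteq> (s ! (i + 1 - k) = Right)"
| "possible_after k s (Flip l) \<longleftrightarrow> s \<noteq> [] \<and> (last s = Right) \<noteq> (l = Right)"

text \<open>With absolute numbering, moves of a suffix act only on a full arm. Hence the quantifier
  over prefixes \<open>a\<close>, of which only the length matters.\<close>

definition represents :: "nat \<Rightarrow> link list \<Rightarrow> move list \<Rightarrow> block list \<Rightarrow> bool" where
  "represents k s ms w \<longleftrightarrow> wf_word w \<and> word_length w = length s \<and> dim w = length ms
     \<and> (\<forall>a. length a = k \<longrightarrow> cube_vertices (a @ s) ms = (@) a ` resolutions w)"

abbreviation disjoint_moves :: "nat \<Rightarrow> move list \<Rightarrow> bool" where
  "disjoint_moves n \<equiv> sorted_wrt (\<lambda>m m'. links_moved n m \<inter> links_moved n m' = {})"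

lemma possible_after_0: "possible_after 0 s m = move_possible s m"
  by (cases m) auto

lemma links_possible_after:
  "possible_after k s m \<Longrightarrow> links_moved (k + length s) m \<subseteq> {k..<k + length s}"
  by (cases m; cases s) auto

lemma not_possible_after_Nil: "\<not> possible_after k [] m"
  by (cases m) auto

text \<open>Moves avoiding the first link are moves of the tail. A \<open>Flip\<close> touches link
  \<open>k\<close> exactly when \<open>t\<close> is empty.\<close>

lemma possible_after_Cons:
  "possible_after k (x # t) m \<and> k \<notin> links_moved (Suc (k + length t)) m
     \<longleftrightarrow> possible_after (Suc k) t m"
proof (cases m)
  case (Switch i)
  show ?thesis
  proof (cases "Suc k \<le> i")
    case True
    then obtain j where "i = Suc k + j" using le_Suc_ex by blast
    then show ?thesis using Switch by (auto simp: nth_Cons Suc_diff_le)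
  qed (use Switch in auto)
qed auto

section \<open>Translation between tuples of moves and block words\<close>

lemma represents_Nil: "represents k [] [] []"
  by (auto simp: represents_def cube_vertices_Nil)

lemma represents_Fixed:
  assumes "represents (Suc k) t ms w"
  shows "represents k (x # t) ms (Fixed x # w)"
proof -
  have "cube_vertices (a @ x # t) ms = (@) a ` (#) x ` resolutions w" if "length a = k" for a
    using assms that unfolding represents_def
    by (auto dest!: spec[of _ "a @ [x]"] simp: image_image)
  then show ?thesis using assms by (auto simp: represents_def)
qed

lemma represents_Corner:
  assumes "represents (Suc (Suc k)) t ms w" "{x, y} = {l, Right}" "l \<noteq> Right"
  shows "represents k (x # y # t) (Switch k # ms) (Corner l # w)"
proof -
  have V: "cube_vertices (a @ x # y # t) ms = (\<lambda>q. a @ x # y # q) ` resolutions w"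
    if "length a = k" for a x y
    using assms that unfolding represents_def
    by (auto dest!: spec[of _ "a @ [x, y]"] simp: image_image)
  have "perform (Switch k) (a @ x # y # t) = a @ y # x # t" if "length a = k" for a
    using that by (auto simp: nth_append list_update_append)
  then have "cube_vertices (a @ x # y # t) (Switch k # ms) = (@) a ` resolutions (Corner l # w)"
    if "length a = k" for a
    using V that assms(2,3)
    by (auto simp: cube_vertices_Cons image_Un image_image doubleton_eq_iff)
  then show ?thesis using assms by (auto simp: represents_def)
qed

lemma represents_End:
  assumes "{x, y} = {l, Right}" "l \<noteq> Right"
  shows "represents k [x] [Flip y] [End l]"
  using assms
  by (auto simp: represents_def cube_vertices_Cons cube_vertices_Nil doubleton_eq_iff)

text \<open>Scan the suffix: an untouched first link becomes \<open>Fixed\<close>; otherwise a move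
  touching it is brought to the front and becomes a \<open>Corner\<close> or an \<open>End\<close>.
  Heights play no part until \<open>cubes_eq\<close>.\<close>

lemma word_of_moves:
  assumes "\<forall>m \<in> set ms. possible_after k s m" "disjoint_moves (k + length s) ms"
  shows "\<exists>w. represents k s ms w"
  using assms
proof (induction "length s" arbitrary: k s ms rule: less_induct)
  case less
  let ?n = "k + length s"
  show ?case
  proof (cases s)
    case Nil
    then have "ms = []" using less.prems(1) not_possible_after_Nil by (cases ms) auto
    then show ?thesis using represents_Nil Nil by blast
  next
    case (Cons x t)
    show ?thesis
    proof (cases "\<exists>m \<in> set ms. k \<in> links_moved ?n m")
      case False
      then have "\<forall>m \<in> set ms. possible_after (Suc k) t m"
        using less.prems(1) Cons possible_after_Cons[of k x t] by auto
      then have "\<exists>w. represents (Suc k) t ms w"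
        using less.prems(2) Cons by (intro less.hyps) auto
      then show ?thesis using represents_Fixed Cons by blast
    next
      case True
      then obtain m xs ys where ms: "ms = xs @ m # ys" and m: "k \<in> links_moved ?n m"
        using split_list by fastforce
      have front: "represents k s ms w" if "represents k s (m # xs @ ys) w" for w
      proof -
        have "cube_vertices (a @ s) ms = cube_vertices (a @ s) (m # xs @ ys)" if "length a = k" for a
          unfolding ms
        proof (rule cube_vertices_move_to_front)
          show "\<forall>x \<in> set xs. links_moved (length (a @ s)) x \<inter> links_moved (length (a @ s)) m = {}"
            using less.prems(2) ms that by (simp add: sorted_wrt_append)
          show "\<forall>x \<in> set (m # xs). links_moved (length (a @ s)) x \<subseteq> {..<length (a @ s)}"
          proof
            fix x assume "x \<in> set (m # xs)"
            then have "possible_after k s x" using less.prems(1) ms by auto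
            then show "links_moved (length (a @ s)) x \<subseteq> {..<length (a @ s)}"
              using links_possible_after[of k s x] that by auto
          qed
        qed
        then show ?thesis using that ms by (auto simp: represents_def)
      qed
      have others: "\<forall>m' \<in> set (xs @ ys). possible_after k s m' \<and> links_moved ?n m' \<inter> links_moved ?n m = {}"
        "disjoint_moves ?n (xs @ ys)"
        using less.prems ms by (auto simp: sorted_wrt_append)
      have others': "\<forall>m' \<in> set (xs @ ys). possible_after (Suc k) t m'"
        using others(1) m possible_after_Cons[of k x t] Cons by auto
      have pm: "possible_after k s m" using less.prems ms by simp
      show ?thesis
      proof (cases m)
        case (Switch i)
        \<comment> \<open>The alternative \<open>i + 1 = k\<close> would start before the
          suffix.\<close>
        then have i: "i = k" using pm m by auto
        then obtain y u where t: "t = y # u" using pm Switch Cons by (cases t) auto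
        \<comment> \<open>Disjointness from \<open>Switch k\<close> also keeps the other moves off
          link \<open>k + 1\<close>, so they act on \<open>u\<close>.\<close>
        have "\<forall>m' \<in> set (xs @ ys). possible_after (Suc (Suc k)) u m'"
          using others' others(1) possible_after_Cons[of "Suc k" y u] t Cons Switch i by auto
        then have "\<exists>w. represents (Suc (Suc k)) u (xs @ ys) w"
          using others(2) t Cons by (intro less.hyps) auto
        moreover have "(x = Right) \<noteq> (y = Right)" using pm Switch i Cons t by auto
        then have "\<exists>l. {x, y} = {l, Right} \<and> l \<noteq> Right"
          by (intro exI[of _ "if x = Right then y else x"]) auto
        ultimately show ?thesis
          using front represents_Corner Switch i Cons t by blast
      next
        case (Flip y)
        \<comment> \<open>A \<open>Flip\<close> touches only the last link, so link \<open>k\<close>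
          is the last one and no link remains for other moves.\<close>
        then have t: "t = []" using m Cons by auto
        then have "xs @ ys = []" using others' not_possible_after_Nil by (cases "xs @ ys") auto
        moreover have "(x = Right) \<noteq> (y = Right)" using pm Flip Cons t by auto
        then have "\<exists>l. {x, y} = {l, Right} \<and> l \<noteq> Right"
          by (intro exI[of _ "if x = Right then y else x"]) auto
        ultimately show ?thesis
          using front represents_End Flip Cons t by metis
      qed
    qed
  qed
qed

text \<open>The base vertex puts the vertical link first in every corner and \<open>Right\<close> at
  a free end.\<close>

lemma moves_of_word:
  assumes "wf_word w"
  shows "\<exists>s ms. represents k s ms w \<and> (\<forall>m \<in> set ms. possible_after k s m)
    \<and> disjoint_moves (k + length s) ms"
  using assms
proof (induction w arbitrary: k rule: wf_word.induct)
  case 1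
  then show ?case using represents_Nil[of k] by fastforce
next
  case (2 l w)
  then obtain s ms where s: "represents (Suc k) s ms w" "\<forall>m \<in> set ms. possible_after (Suc k) s m"
    "disjoint_moves (Suc k + length s) ms" by fastforce
  have "\<forall>m \<in> set ms. possible_after k (l # s) m"
    using s(2) possible_after_Cons by blast
  moreover have "disjoint_moves (k + length (l # s)) ms"
    using s(3) by simp
  ultimately show ?case using represents_Fixed[OF s(1)] by blast
next
  case (3 l w)
  then obtain s ms where s: "represents (Suc (Suc k)) s ms w"
    "\<forall>m \<in> set ms. possible_after (Suc (Suc k)) s m"
    "disjoint_moves (Suc (Suc k) + length s) ms" by fastforce
  have l: "l \<noteq> Right" using 3 by simp
  have "\<forall>m \<in> set ms. possible_after k (l # Right # s) m"
    using s(2) possible_after_Cons by blast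
  moreover have "links_moved (k + length (l # Right # s)) m \<inter> {k, Suc k} = {}" if "m \<in> set ms" for m
    using links_possible_after[of "Suc (Suc k)" s m] s(2) that by fastforce
  ultimately have "\<forall>m \<in> set (Switch k # ms). possible_after k (l # Right # s) m"
    "disjoint_moves (k + length (l # Right # s)) (Switch k # ms)"
    using s(3) l by auto
  moreover have "represents k (l # Right # s) (Switch k # ms) (Corner l # w)"
    using s(1) l by (intro represents_Corner) auto
  ultimately show ?case by blast
next
  case (4 l w)
  then have "represents k [Right] [Flip l] (End l # w)"
    using represents_End[of Right l l k] by auto
  moreover have "\<forall>m \<in> set [Flip l]. possible_after k [Right] m" using 4 by simp
  moreover have "disjoint_moves (k + length [Right]) [Flip l]" by simp
  ultimately show ?case by blast
qed

lemma represents_0: "represents 0 p ms w \<Longrightarrow> cube_vertices p ms = resolutions w"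
  unfolding represents_def by (metis append_Nil image_cong image_ident list.size(3))

text \<open>The two translations match moves with well-formed words. Requiring all vertices to be
  positions then amounts to \<open>valid_word\<close> from the initial state.\<close>

lemma cubes_eq: "cubes n k = resolutions ` {w \<in> words n Right 0. dim w = k}"
proof (intro equalityI subsetI)
  fix C assume "C \<in> cubes n k"
  then obtain p ms where C: "C = cube_vertices p ms" and p: "p \<in> positions n" "length ms = k"
    "commutative_moves n p ms"
    by (auto simp: cubes_def)
  have len: "length p = n" using p(1) by (simp add: positions_eq)
  have "\<forall>m \<in> set ms. possible_after 0 p m" "disjoint_moves (0 + length p) ms"
    using p(3) len
    by (auto simp: possible_after_0 commutative_moves_def legal_move_def sorted_wrt_iff_nth_less)
  then obtain w where w: "represents 0 p ms w" using word_of_moves by blast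
  then have C': "C = resolutions w" using C represents_0 by simp
  have "resolutions w \<subseteq> positions n" using p(3) C C' by (simp add: commutative_moves_def)
  then have "valid_word Right 0 w"
    using w by (auto simp: represents_def positions_eq valid_word_iff)
  then have "w \<in> words n Right 0" "dim w = k"
    using w len p(2) by (auto simp: represents_def words_def)
  then show "C \<in> resolutions ` {w \<in> words n Right 0. dim w = k}" using C' by blast
next
  fix C assume "C \<in> resolutions ` {w \<in> words n Right 0. dim w = k}"
  then obtain w where C: "C = resolutions w" and w: "valid_word Right 0 w" "word_length w = n" "dim w = k"
    by (auto simp: words_def)
  then obtain p ms where p: "represents 0 p ms w" "\<forall>m \<in> set ms. possible_after 0 p m"
    "disjoint_moves (0 + length p) ms"
    using moves_of_word valid_word_iff by blast
  have V: "cube_vertices p ms = resolutions w" using p(1) by (rule represents_0)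
  have len: "length p = n" "length ms = k" using p(1) w by (auto simp: represents_def)
  have sub: "cube_vertices p ms \<subseteq> positions n"
    using V w length_resolutions[of _ w] by (auto simp: positions_eq valid_word_iff)
  \<comment> \<open>The result of each single move is itself a vertex of the cube, so legality
    follows from \<open>sub\<close>.\<close>
  then have "commutative_moves n p ms"
    using p len perform_in_cube_vertices[of _ ms p]
    by (auto simp: possible_after_0 commutative_moves_def legal_move_def sorted_wrt_iff_nth_less)
  moreover have "p \<in> positions n" using sub base_in_cube_vertices by blast
  ultimately show "C \<in> cubes n k" using C V len unfolding cubes_def by blast
qed

theorem theorem1p5:
  fixes n :: nat
  shows "euler_characteristic n = 1"
proof -
  let ?W = "words n Right 0"
  have inj: "inj_on resolutions ?W"
    by (rule inj_onI) (auto simp: words_def valid_word_iff intro: resolutions_inj)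
  have card: "card (cubes n d) = card {w \<in> ?W. dim w = d}" for d
    unfolding cubes_eq by (rule card_image, rule inj_on_subset[OF inj]) auto
  \<comment> \<open>With the support written as an image of \<open>dim\<close>, the alternating sum
    is the signed count of words grouped by dimension.\<close>
  have "{d. cubes n d \<noteq> {}} = dim ` ?W"
    by (auto simp: cubes_eq)
  then have "euler_characteristic n = (\<Sum>d \<in> dim ` ?W. (- 1) ^ d * int (card {w \<in> ?W. dim w = d}))"
    by (simp add: euler_characteristic_def card)
  also have "\<dots> = (\<Sum>d \<in> dim ` ?W. \<Sum>w \<in> {w \<in> ?W. dim w = d}. (- 1) ^ dim w)"
    by (intro sum.cong) auto
  also have "\<dots> = (\<Sum>w \<in> ?W. (- 1) ^ dim w)"
    by (rule sum.image_gen[symmetric]) (rule finite_words)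
  also have "\<dots> = 1" by (rule signed_count_words)
  finally show ?thesis .
qed

end
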